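(* Let $T=M\times_\Phi^q S$ be a tight twisted product. If $\xi$ is any of Green's relations (any of the pre-orders $\leq_{\mathscr L},\leq_{\mathscr R},\leq_{\mathscr J},\leq_{\mathscr H}$ or equivalences $\mathscr L,\mathscr R,\mathscr J,\mathscr H,\mathscr D$), and $\xi^M,\xi^S,\xi^T$ denote this relation on $M$, $S$ and $T$ respectively, then for all $i,j\in M$ and $a,b\in S$, $$(i,a)\ \xi^T\ (j,b)\quad\Longleftrightarrow\quad i\ \xi^M\ j\ \text{ and }\ a\ \xi^S\ b.$$
   Context: $S$ is a monoid (multiplicative, identity $1$); $M$ is a commutative monoid (additive, identity $0$); $q\in M$ is fixed; $\mathbb N=\{0,1,2,\dots\}$. A twisting of $S$ is a map $\Phi:S\times S\to\mathbb N$ with $\Phi(a,b)+\Phi(ab,c)=\Phi(a,bc)+\Phi(b,c)$ for all $a,b,c\in S$. It is tight if (a) for all $a,b\in S$ there is $a'\in S$ with $ab=a'b$ and $\Phi(a',b)=0$; and (b) for all $a,b\in S$ there is $b'\in S$ with $ab=ab'$ and $\Phi(a,b')=0$. The twisted product $M\times_\Phi^qS$ is the semigroup with underlying set $M\times S$ and product $(i,a)(j,b)=(i+j+\Phi(a,b)q,\,ab)$, where for $n\in\mathbb N$, $nq$ is the $n$-fold sum of $q$ in $M$ (and $0q=0$); it is called tight if $\Phi$ is tight (in which case it is a monoid with identity $(0,1)$). Green's relations on a monoid $X$ (written multiplicatively): $a\leq_{\mathscr L}b\iff Xa\subseteq Xb$; $a\leq_{\mathscr R}b\iff aX\subseteq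 bX$; $a\leq_{\mathscr J}b\iff XaX\subseteq XbX$; $\leq_{\mathscr H}$ is the intersection of $\leq_{\mathscr L}$ and $\leq_{\mathscr R}$; $\mathscr L,\mathscr R,\mathscr J,\mathscr H$ are the corresponding equivalences ($a\,\mathscr K\,b$ iff $a\leq_{\mathscr K}b$ and $b\leq_{\mathscr K}a$), and $\mathscr D=\mathscr L\vee\mathscr R$ is the join in the lattice of equivalence relations. *)

theory Defs
  imports "HOL-Algebra.Coset"
begin

text \<open>The commutative monoid written additively in the mathematics is a \<^locale>\<open>comm_monoid\<close>,
  hence multiplicative here: its operation is the monoid product of M, its neutral element is the
  unit of M, and the n-fold sum of q is the power of q in M with exponent n.\<close>

definition twisting :: "('s, 'y) monoid_scheme \<Rightarrow> ('s \<Rightarrow> 's \<Rightarrow> nat) \<Rightarrow> bool" where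
  "twisting S \<Phi> \<longleftrightarrow>
     (\<forall>a\<in>carrier S. \<forall>b\<in>carrier S. \<forall>c\<in>carrier S.
        \<Phi> a b + \<Phi> (a \<otimes>\<^bsub>S\<^esub> b) c = \<Phi> a (b \<otimes>\<^bsub>S\<^esub> c) + \<Phi> b c)"

definition tight :: "('s, 'y) monoid_scheme \<Rightarrow> ('s \<Rightarrow> 's \<Rightarrow> nat) \<Rightarrow> bool" where
  "tight S \<Phi> \<longleftrightarrow>
     (\<forall>a\<in>carrier S. \<forall>b\<in>carrier S. \<exists>a'\<in>carrier S. a \<otimes>\<^bsub>S\<^esub> b = a' \<otimes>\<^bsub>S\<^esub> b \<and> \<Phi> a' b = 0) \<and>
     (\<forall>a\<in>carrier S. \<forall>b\<in>carrier S. \<exists>b'\<in>carrier S. a \<otimes>\<^bsub>S\<^esub> b = a \<otimes>\<^bsub>S\<^esub> b' \<and> \<Phi> a b' = 0)"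

text \<open>For an arbitrary twisting the twisted product is only a semigroup; the designated unit is
  a neutral element as soon as the twisting is tight (lemma \<open>monoid_twisted_product\<close>).\<close>

definition twisted_product ::
  "('m, 'x) monoid_scheme \<Rightarrow> 'm \<Rightarrow> ('s \<Rightarrow> 's \<Rightarrow> nat) \<Rightarrow> ('s, 'y) monoid_scheme \<Rightarrow> ('m \<times> 's) monoid" where
  "twisted_product M q \<Phi> S =
     \<lparr>carrier = carrier M \<times> carrier S,
      mult = (\<lambda>(i, a) (j, b). (i \<otimes>\<^bsub>M\<^esub> j \<otimes>\<^bsub>M\<^esub> (q [^]\<^bsub>M\<^esub> \<Phi> a b), a \<otimes>\<^bsub>S\<^esub> b)),
      one = (\<one>\<^bsub>M\<^esub>, \<one>\<^bsub>S\<^esub>)\<rparr>"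

lemma monoid_twisted_product:
  assumes S: "monoid S" and M: "comm_monoid M" and q: "q \<in> carrier M"
    and tw: "twisting S \<Phi>" and ti: "tight S \<Phi>"
  shows "monoid (twisted_product M q \<Phi> S)"
proof -
  interpret S: monoid S by (rule S)
  interpret M: comm_monoid M by (rule M)
  have tw': "\<Phi> a b + \<Phi> (a \<otimes>\<^bsub>S\<^esub> b) c = \<Phi> a (b \<otimes>\<^bsub>S\<^esub> c) + \<Phi> b c"
    if "a \<in> carrier S" "b \<in> carrier S" "c \<in> carrier S" for a b c
    using tw that unfolding twisting_def by blast
  obtain a' where "a' \<in> carrier S" "\<one>\<^bsub>S\<^esub> \<otimes>\<^bsub>S\<^esub> \<one>\<^bsub>S\<^esub> = a' \<otimes>\<^bsub>S\<^esub> \<one>\<^bsub>S\<^esub>" "\<Phi> a' \<one>\<^bsub>S\<^esub> = 0"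
    using ti S.one_closed unfolding tight_def by blast
  then have 11: "\<Phi> \<one>\<^bsub>S\<^esub> \<one>\<^bsub>S\<^esub> = 0" by simp
  have l1: "\<Phi> \<one>\<^bsub>S\<^esub> a = 0" if "a \<in> carrier S" for a
    using tw'[of "\<one>\<^bsub>S\<^esub>" "\<one>\<^bsub>S\<^esub>" a] 11 that by simp
  have r1: "\<Phi> a \<one>\<^bsub>S\<^esub> = 0" if "a \<in> carrier S" for a
    using tw'[of a "\<one>\<^bsub>S\<^esub>" "\<one>\<^bsub>S\<^esub>"] 11 that by simp
  have assoc: "i \<otimes>\<^bsub>M\<^esub> j \<otimes>\<^bsub>M\<^esub> (q [^]\<^bsub>M\<^esub> \<Phi> a b) \<otimes>\<^bsub>M\<^esub> k \<otimes>\<^bsub>M\<^esub> (q [^]\<^bsub>M\<^esub> \<Phi> (a \<otimes>\<^bsub>S\<^esub> b) c)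
      = i \<otimes>\<^bsub>M\<^esub> (j \<otimes>\<^bsub>M\<^esub> k \<otimes>\<^bsub>M\<^esub> (q [^]\<^bsub>M\<^esub> \<Phi> b c)) \<otimes>\<^bsub>M\<^esub> (q [^]\<^bsub>M\<^esub> \<Phi> a (b \<otimes>\<^bsub>S\<^esub> c))"
    if "i \<in> carrier M" "j \<in> carrier M" "k \<in> carrier M"
       "a \<in> carrier S" "b \<in> carrier S" "c \<in> carrier S" for i j k a b c
  proof -
    have "(q [^]\<^bsub>M\<^esub> \<Phi> a b) \<otimes>\<^bsub>M\<^esub> (q [^]\<^bsub>M\<^esub> \<Phi> (a \<otimes>\<^bsub>S\<^esub> b) c)
        = (q [^]\<^bsub>M\<^esub> \<Phi> b c) \<otimes>\<^bsub>M\<^esub> (q [^]\<^bsub>M\<^esub> \<Phi> a (b \<otimes>\<^bsub>S\<^esub> c))"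
      using tw'[of a b c] that q by (simp add: M.nat_pow_mult add.commute)
    then have "i \<otimes>\<^bsub>M\<^esub> j \<otimes>\<^bsub>M\<^esub> k \<otimes>\<^bsub>M\<^esub> ((q [^]\<^bsub>M\<^esub> \<Phi> a b) \<otimes>\<^bsub>M\<^esub> (q [^]\<^bsub>M\<^esub> \<Phi> (a \<otimes>\<^bsub>S\<^esub> b) c))
        = i \<otimes>\<^bsub>M\<^esub> j \<otimes>\<^bsub>M\<^esub> k \<otimes>\<^bsub>M\<^esub> ((q [^]\<^bsub>M\<^esub> \<Phi> b c) \<otimes>\<^bsub>M\<^esub> (q [^]\<^bsub>M\<^esub> \<Phi> a (b \<otimes>\<^bsub>S\<^esub> c)))"
      by simp
    then show ?thesis
      using that q by (simp add: M.m_ac)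
  qed
  show ?thesis
    by (rule monoidI) (auto simp: twisted_product_def l1 r1 q assoc S.m_assoc)
qed

definition green_le_L :: "('a, 'b) monoid_scheme \<Rightarrow> 'a rel" where
  "green_le_L X = {(a, b). a \<in> carrier X \<and> b \<in> carrier X \<and>
     carrier X #>\<^bsub>X\<^esub> a \<subseteq> carrier X #>\<^bsub>X\<^esub> b}"

definition green_le_R :: "('a, 'b) monoid_scheme \<Rightarrow> 'a rel" where
  "green_le_R X = {(a, b). a \<in> carrier X \<and> b \<in> carrier X \<and>
     a <#\<^bsub>X\<^esub> carrier X \<subseteq> b <#\<^bsub>X\<^esub> carrier X}"

definition green_le_J :: "('a, 'b) monoid_scheme \<Rightarrow> 'a rel" where
  "green_le_J X = {(a, b). a \<in> carrier X \<and> b \<in> carrier X \<and>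
     (carrier X #>\<^bsub>X\<^esub> a) <#>\<^bsub>X\<^esub> carrier X \<subseteq> (carrier X #>\<^bsub>X\<^esub> b) <#>\<^bsub>X\<^esub> carrier X}"

definition green_le_H :: "('a, 'b) monoid_scheme \<Rightarrow> 'a rel" where
  "green_le_H X = green_le_L X \<inter> green_le_R X"

definition green_L :: "('a, 'b) monoid_scheme \<Rightarrow> 'a rel" where
  "green_L X = green_le_L X \<inter> (green_le_L X)\<inverse>"

definition green_R :: "('a, 'b) monoid_scheme \<Rightarrow> 'a rel" where
  "green_R X = green_le_R X \<inter> (green_le_R X)\<inverse>"

definition green_J :: "('a, 'b) monoid_scheme \<Rightarrow> 'a rel" where
  "green_J X = green_le_J X \<inter> (green_le_J X)\<inverse>"

definition green_H :: "('a, 'b) monoid_scheme \<Rightarrow> 'a rel" where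
  "green_H X = green_le_H X \<inter> (green_le_H X)\<inverse>"

text \<open>The join of L and R in the lattice of equivalence relations on the carrier is the least such
  equivalence relation containing both.\<close>

definition green_D :: "('a, 'b) monoid_scheme \<Rightarrow> 'a rel" where
  "green_D X = \<Inter> {E. equiv (carrier X) E \<and> green_L X \<subseteq> E \<and> green_R X \<subseteq> E}"

text \<open>A variable ranging over relations on one monoid cannot be instantiated at three monoids over
  different types, so Green's relations are quantified over by name.\<close>

datatype green = Le_L | Le_R | Le_J | Le_H | Eq_L | Eq_R | Eq_J | Eq_H | Eq_D

primrec green_rel :: "green \<Rightarrow> ('a, 'b) monoid_scheme \<Rightarrow> 'a rel" where
  "green_rel Le_L X = green_le_L X"
| "green_rel Le_R X = green_le_R X"
| "green_rel Le_J X = green_le_J X"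
| "green_rel Le_H X = green_le_H X"
| "green_rel Eq_L X = green_L X"
| "green_rel Eq_R X = green_R X"
| "green_rel Eq_J X = green_J X"
| "green_rel Eq_H X = green_H X"
| "green_rel Eq_D X = green_D X"

end

theory Submission
  imports Defs
begin

text \<open>In a monoid, the pre-orders are divisibility relations, e.g. \<open>a \<le>\<^sub>L b\<close> iff \<open>a = xb\<close>. A divisibility
  in \<open>T\<close> projects to divisibilities in \<open>M\<close> (where the powers of \<open>q\<close> are absorbed by the quotient)
  and in \<open>S\<close>; conversely, tightness lets one choose the quotients in \<open>S\<close> so that no power of \<open>q\<close>
  appears. For \<open>D\<close>, commutativity makes \<open>D = L\<close> in \<open>M\<close>, and \<open>(i, a) L (j, a) D (j, b)\<close>.\<close>

section \<open>Green's pre-orders as divisibility in a monoid\<close>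

context monoid
begin

text \<open>Since the identity puts \<open>a\<close> into its own left ideal, inclusion of ideals
  yields a quotient \<open>x\<close>; conversely, associativity pushes every multiple of
  \<open>x \<otimes> b\<close> into the left ideal of \<open>b\<close>.\<close>

lemma green_le_L_iff:
  "(a, b) \<in> green_le_L G \<longleftrightarrow> a \<in> carrier G \<and> b \<in> carrier G \<and> (\<exists>x\<in>carrier G. a = x \<otimes> b)"
proof -
  have mem: "z \<in> carrier G #> b \<longleftrightarrow> (\<exists>x\<in>carrier G. z = x \<otimes> b)" for z
    by (auto simp: r_coset_def)
  have "carrier G #> a \<subseteq> carrier G #> b"
    if "b \<in> carrier G" "x \<in> carrier G" "a = x \<otimes> b" for x
    using that by (auto simp: r_coset_def simp flip: m_assoc)
  moreover have "a \<in> carrier G #> a" if "a \<in> carrier G"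
    using that by (auto simp: r_coset_def intro!: bexI[of _ \<one>])
  ultimately show ?thesis
    unfolding green_le_L_def using mem by blast
qed

lemma green_le_R_iff:
  "(a, b) \<in> green_le_R G \<longleftrightarrow> a \<in> carrier G \<and> b \<in> carrier G \<and> (\<exists>x\<in>carrier G. a = b \<otimes> x)"
proof -
  have mem: "z \<in> b <# carrier G \<longleftrightarrow> (\<exists>x\<in>carrier G. z = b \<otimes> x)" for z
    by (auto simp: l_coset_def)
  have "a <# carrier G \<subseteq> b <# carrier G"
    if "b \<in> carrier G" "x \<in> carrier G" "a = b \<otimes> x" for x
    using that by (auto simp: l_coset_def m_assoc)
  moreover have "a \<in> a <# carrier G" if "a \<in> carrier G"
    using that by (auto simp: l_coset_def intro!: bexI[of _ \<one>])
  ultimately show ?thesis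
    unfolding green_le_R_def using mem by blast
qed

lemma green_le_J_iff:
  "(a, b) \<in> green_le_J G \<longleftrightarrow>
     a \<in> carrier G \<and> b \<in> carrier G \<and> (\<exists>x\<in>carrier G. \<exists>y\<in>carrier G. a = x \<otimes> b \<otimes> y)"
proof -
  have mem: "z \<in> (carrier G #> c) <#> carrier G \<longleftrightarrow>
      (\<exists>x\<in>carrier G. \<exists>y\<in>carrier G. z = x \<otimes> c \<otimes> y)" for z c
    by (auto simp: r_coset_def set_mult_def)
  have "z \<in> (carrier G #> b) <#> carrier G"
    if "b \<in> carrier G" "x \<in> carrier G" "y \<in> carrier G" "a = x \<otimes> b \<otimes> y"
      and z: "z \<in> (carrier G #> a) <#> carrier G" for x y z
  proof -
    obtain u v where uv: "u \<in> carrier G" "v \<in> carrier G" "z = u \<otimes> a \<otimes> v"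
      using z mem by blast
    then have "z = (u \<otimes> x) \<otimes> b \<otimes> (y \<otimes> v)"
      using that by (simp add: m_assoc)
    then show ?thesis
      using mem that uv by blast
  qed
  moreover have "a \<in> (carrier G #> a) <#> carrier G" if "a \<in> carrier G"
    using that by (auto simp: mem intro!: bexI[of _ \<one>])
  ultimately show ?thesis
    unfolding green_le_J_def using mem by blast
qed

lemma equiv_green_L: "equiv (carrier G) (green_L G)"
  by (rule equivI) (auto simp: green_L_def green_le_L_def refl_on_def sym_def trans_def)

end

section \<open>The relation D as a least equivalence\<close>

lemma green_L_carrier: "green_L X \<subseteq> carrier X \<times> carrier X"
  by (auto simp: green_L_def green_le_L_def)

lemma green_R_carrier: "green_R X \<subseteq> carrier X \<times> carrier X"
  by (auto simp: green_R_def green_le_R_def)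

lemma green_L_subset_D: "green_L X \<subseteq> green_D X"
  unfolding green_D_def by blast

lemma green_R_subset_D: "green_R X \<subseteq> green_D X"
  unfolding green_D_def by blast

text \<open>Serves as the induction principle for D: a property of all D-related pairs follows once
  it is seen to define an equivalence on the carrier that contains L and R.\<close>

lemma green_D_least:
  assumes "equiv (carrier X) E" "green_L X \<subseteq> E" "green_R X \<subseteq> E"
  shows "green_D X \<subseteq> E"
  using assms unfolding green_D_def by blast

lemma equiv_green_D: "equiv (carrier X) (green_D X)"
proof (rule equivI)
  \<comment> \<open>The total relation is a member of the family being intersected. An intersection
    over an empty family would be everything and would not stay inside the carrier.\<close>
  have "equiv (carrier X) (carrier X \<times> carrier X)"
    by (rule equivI) (auto simp: refl_on_def sym_def trans_def)
  then show "green_D X \<subseteq> carrier X \<times> carrier X"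
    by (rule green_D_least[OF _ green_L_carrier green_R_carrier])
  show "refl_on (carrier X) (green_D X)"
    by (auto simp: green_D_def equiv_def refl_on_def)
  show "sym (green_D X)"
    unfolding green_D_def equiv_def sym_def by blast
  show "trans (green_D X)"
    unfolding green_D_def equiv_def trans_def by blast
qed

context comm_monoid
begin

lemma green_R_eq_L: "green_R G = green_L G"
proof -
  have "(x, y) \<in> green_le_R G \<longleftrightarrow> (x, y) \<in> green_le_L G" for x y
    by (auto simp: green_le_R_iff green_le_L_iff m_comm)
  then show ?thesis
    by (auto simp: green_R_def green_L_def)
qed

text \<open>As R and L coincide here, L is itself an equivalence containing both, hence the least
  one.\<close>

lemma green_D_eq_L: "green_D G = green_L G"
  using green_D_least[OF equiv_green_L] green_L_subset_D green_R_eq_L by blast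

end

section \<open>Tight twisted products: the pre-orders\<close>

locale tight_twisted_product =
  M: comm_monoid M + S: monoid S
  for M :: "('m, 'x) monoid_scheme" and S :: "('s, 'y) monoid_scheme"
    and q :: 'm and \<Phi> :: "'s \<Rightarrow> 's \<Rightarrow> nat" +
  assumes q_closed [simp]: "q \<in> carrier M"
    and twisting: "twisting S \<Phi>"
    and tight: "tight S \<Phi>"
begin

abbreviation T where "T \<equiv> twisted_product M q \<Phi> S"

sublocale T: monoid T
  by (rule monoid_twisted_product)
    (use twisting tight M.comm_monoid_axioms S.monoid_axioms in auto)

lemma carrier_T [simp]: "carrier T = carrier M \<times> carrier S"
  by (simp add: twisted_product_def)

lemma mult_T [simp]:
  "(i, a) \<otimes>\<^bsub>T\<^esub> (j, b) = (i \<otimes>\<^bsub>M\<^esub> j \<otimes>\<^bsub>M\<^esub> (q [^]\<^bsub>M\<^esub> \<Phi> a b), a \<otimes>\<^bsub>S\<^esub> b)"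
  by (simp add: twisted_product_def)

text \<open>Used to exchange a left quotient in \<open>S\<close> for one that gives the same product
  but contributes no power of \<open>q\<close> in \<open>T\<close>.\<close>

lemma untwist_left:
  assumes "a \<in> carrier S" "b \<in> carrier S"
  obtains a' where "a' \<in> carrier S" "a \<otimes>\<^bsub>S\<^esub> b = a' \<otimes>\<^bsub>S\<^esub> b" "\<Phi> a' b = 0"
  using tight assms unfolding tight_def by blast

lemma untwist_right:
  assumes "a \<in> carrier S" "b \<in> carrier S"
  obtains b' where "b' \<in> carrier S" "a \<otimes>\<^bsub>S\<^esub> b = a \<otimes>\<^bsub>S\<^esub> b'" "\<Phi> a b' = 0"
  using tight assms unfolding tight_def by blast

lemma le_L: "((i, a), (j, b)) \<in> green_le_L T \<longleftrightarrow> (i, j) \<in> green_le_L M \<and> (a, b) \<in> green_le_L S"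
proof
  assume "((i, a), (j, b)) \<in> green_le_L T"
  then obtain k c where *: "i \<in> carrier M" "a \<in> carrier S" "j \<in> carrier M" "b \<in> carrier S"
      "k \<in> carrier M" "c \<in> carrier S"
      "i = k \<otimes>\<^bsub>M\<^esub> j \<otimes>\<^bsub>M\<^esub> (q [^]\<^bsub>M\<^esub> \<Phi> c b)" "a = c \<otimes>\<^bsub>S\<^esub> b"
    by (auto simp: T.green_le_L_iff)
  \<comment> \<open>Commutativity of \<open>M\<close> moves the power of \<open>q\<close> past
    \<open>j\<close>, so that it becomes part of the quotient.\<close>
  then have "i = (k \<otimes>\<^bsub>M\<^esub> (q [^]\<^bsub>M\<^esub> \<Phi> c b)) \<otimes>\<^bsub>M\<^esub> j"
    by (simp add: M.m_ac)
  then show "(i, j) \<in> green_le_L M \<and> (a, b) \<in> green_le_L S"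
    unfolding M.green_le_L_iff S.green_le_L_iff using * M.m_closed M.nat_pow_closed q_closed by metis
next
  assume "(i, j) \<in> green_le_L M \<and> (a, b) \<in> green_le_L S"
  then obtain k c where *: "i \<in> carrier M" "a \<in> carrier S" "j \<in> carrier M" "b \<in> carrier S"
      "k \<in> carrier M" "c \<in> carrier S" "i = k \<otimes>\<^bsub>M\<^esub> j" "a = c \<otimes>\<^bsub>S\<^esub> b"
    by (auto simp: M.green_le_L_iff S.green_le_L_iff)
  obtain c' where "c' \<in> carrier S" "c \<otimes>\<^bsub>S\<^esub> b = c' \<otimes>\<^bsub>S\<^esub> b" "\<Phi> c' b = 0"
    using untwist_left * by blast
  with * have "(i, a) = (k, c') \<otimes>\<^bsub>T\<^esub> (j, b)" "(k, c') \<in> carrier T"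
    by simp_all
  with * show "((i, a), (j, b)) \<in> green_le_L T"
    unfolding T.green_le_L_iff by (metis carrier_T SigmaI)
qed

text \<open>Dual to \<open>le_L\<close>. The quotient \<open>k\<close> already stands next to the
  power of \<open>q\<close>, so associativity alone absorbs it; the converse uses the other half of
  tightness.\<close>

lemma le_R: "((i, a), (j, b)) \<in> green_le_R T \<longleftrightarrow> (i, j) \<in> green_le_R M \<and> (a, b) \<in> green_le_R S"
proof
  assume "((i, a), (j, b)) \<in> green_le_R T"
  then obtain k c where *: "i \<in> carrier M" "a \<in> carrier S" "j \<in> carrier M" "b \<in> carrier S"
      "k \<in> carrier M" "c \<in> carrier S"
      "i = j \<otimes>\<^bsub>M\<^esub> k \<otimes>\<^bsub>M\<^esub> (q [^]\<^bsub>M\<^esub> \<Phi> b c)" "a = b \<otimes>\<^bsub>S\<^esub> c"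
    by (auto simp: T.green_le_R_iff)
  then have "i = j \<otimes>\<^bsub>M\<^esub> (k \<otimes>\<^bsub>M\<^esub> (q [^]\<^bsub>M\<^esub> \<Phi> b c))"
    by (simp add: M.m_assoc)
  then show "(i, j) \<in> green_le_R M \<and> (a, b) \<in> green_le_R S"
    unfolding M.green_le_R_iff S.green_le_R_iff using * M.m_closed M.nat_pow_closed q_closed by metis
next
  assume "(i, j) \<in> green_le_R M \<and> (a, b) \<in> green_le_R S"
  then obtain k c where *: "i \<in> carrier M" "a \<in> carrier S" "j \<in> carrier M" "b \<in> carrier S"
      "k \<in> carrier M" "c \<in> carrier S" "i = j \<otimes>\<^bsub>M\<^esub> k" "a = b \<otimes>\<^bsub>S\<^esub> c"
    by (auto simp: M.green_le_R_iff S.green_le_R_iff)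
  obtain c' where "c' \<in> carrier S" "b \<otimes>\<^bsub>S\<^esub> c = b \<otimes>\<^bsub>S\<^esub> c'" "\<Phi> b c' = 0"
    using untwist_right * by blast
  with * have "(i, a) = (j, b) \<otimes>\<^bsub>T\<^esub> (k, c')" "(k, c') \<in> carrier T"
    by simp_all
  with * show "((i, a), (j, b)) \<in> green_le_R T"
    unfolding T.green_le_R_iff by (metis carrier_T SigmaI)
qed

lemma le_J: "((i, a), (j, b)) \<in> green_le_J T \<longleftrightarrow> (i, j) \<in> green_le_J M \<and> (a, b) \<in> green_le_J S"
proof
  assume "((i, a), (j, b)) \<in> green_le_J T"
  then obtain k c l d where *: "i \<in> carrier M" "a \<in> carrier S" "j \<in> carrier M" "b \<in> carrier S"
      "k \<in> carrier M" "c \<in> carrier S" "l \<in> carrier M" "d \<in> carrier S"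
      "i = k \<otimes>\<^bsub>M\<^esub> j \<otimes>\<^bsub>M\<^esub> (q [^]\<^bsub>M\<^esub> \<Phi> c b) \<otimes>\<^bsub>M\<^esub> l \<otimes>\<^bsub>M\<^esub> (q [^]\<^bsub>M\<^esub> \<Phi> (c \<otimes>\<^bsub>S\<^esub> b) d)"
      "a = c \<otimes>\<^bsub>S\<^esub> b \<otimes>\<^bsub>S\<^esub> d"
    by (auto simp: T.green_le_J_iff)
  \<comment> \<open>Both powers of \<open>q\<close> are collected with \<open>l\<close> into a
    single right quotient.\<close>
  then have "i = k \<otimes>\<^bsub>M\<^esub> j \<otimes>\<^bsub>M\<^esub> ((q [^]\<^bsub>M\<^esub> \<Phi> c b) \<otimes>\<^bsub>M\<^esub> l \<otimes>\<^bsub>M\<^esub> (q [^]\<^bsub>M\<^esub> \<Phi> (c \<otimes>\<^bsub>S\<^esub> b) d))"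
    by (simp add: M.m_assoc)
  then show "(i, j) \<in> green_le_J M \<and> (a, b) \<in> green_le_J S"
    unfolding M.green_le_J_iff S.green_le_J_iff using * M.m_closed M.nat_pow_closed q_closed by metis
next
  assume "(i, j) \<in> green_le_J M \<and> (a, b) \<in> green_le_J S"
  then obtain k c l d where *: "i \<in> carrier M" "a \<in> carrier S" "j \<in> carrier M" "b \<in> carrier S"
      "k \<in> carrier M" "c \<in> carrier S" "l \<in> carrier M" "d \<in> carrier S"
      "i = k \<otimes>\<^bsub>M\<^esub> j \<otimes>\<^bsub>M\<^esub> l" "a = c \<otimes>\<^bsub>S\<^esub> b \<otimes>\<^bsub>S\<^esub> d"
    by (auto simp: M.green_le_J_iff S.green_le_J_iff)
  \<comment> \<open>The two factors are untwisted in turn: first \<open>c\<close> against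
    \<open>b\<close>, then \<open>d\<close> against the product \<open>c' \<otimes> b\<close>
    already formed. The second exchange leaves \<open>\<Phi> c' b = 0\<close> intact, so both twists
    vanish in the triple product.\<close>
  obtain c' where c': "c' \<in> carrier S" "c \<otimes>\<^bsub>S\<^esub> b = c' \<otimes>\<^bsub>S\<^esub> b" "\<Phi> c' b = 0"
    using untwist_left * by blast
  obtain d' where d': "d' \<in> carrier S" "c' \<otimes>\<^bsub>S\<^esub> b \<otimes>\<^bsub>S\<^esub> d = c' \<otimes>\<^bsub>S\<^esub> b \<otimes>\<^bsub>S\<^esub> d'"
      "\<Phi> (c' \<otimes>\<^bsub>S\<^esub> b) d' = 0"
    using untwist_right[of "c' \<otimes>\<^bsub>S\<^esub> b" d] * c' by blast
  have "(i, a) = (k, c') \<otimes>\<^bsub>T\<^esub> (j, b) \<otimes>\<^bsub>T\<^esub> (l, d')" "(k, c') \<in> carrier T" "(l, d') \<in> carrier T"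
    using * c' d' by simp_all
  with * show "((i, a), (j, b)) \<in> green_le_J T"
    unfolding T.green_le_J_iff by (metis carrier_T SigmaI)
qed

section \<open>Tight twisted products: the equivalences\<close>

lemma eq_L: "((i, a), (j, b)) \<in> green_L T \<longleftrightarrow> (i, j) \<in> green_L M \<and> (a, b) \<in> green_L S"
  by (auto simp: green_L_def le_L)

lemma eq_R: "((i, a), (j, b)) \<in> green_R T \<longleftrightarrow> (i, j) \<in> green_R M \<and> (a, b) \<in> green_R S"
  by (auto simp: green_R_def le_R)

lemma eq_D_project:
  assumes "((i, a), (j, b)) \<in> green_D T"
  shows "(i, j) \<in> green_D M \<and> (a, b) \<in> green_D S"
proof -
  \<comment> \<open>\<open>E\<close> is the product of the D-relations of \<open>M\<close> and
    \<open>S\<close>. It is an equivalence on \<open>T\<close> containing L and R by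
    \<open>eq_L\<close> and \<open>eq_R\<close>, so it contains D of \<open>T\<close>.\<close>
  define E where "E = {((i, a), (j, b)). (i, j) \<in> green_D M \<and> (a, b) \<in> green_D S}"
  note eqM = equiv_green_D[of M] and eqS = equiv_green_D[of S]
  have "equiv (carrier T) E"
  proof (rule equivI)
    show "E \<subseteq> carrier T \<times> carrier T"
      using eqM eqS by (auto simp: E_def equiv_def)
    show "refl_on (carrier T) E"
      using eqM eqS by (auto simp: E_def equiv_def refl_on_def)
    show "sym E"
      using eqM eqS by (auto simp: E_def equiv_def sym_def)
    show "trans E"
      using eqM eqS unfolding E_def equiv_def trans_def by blast
  qed
  moreover have "green_L T \<subseteq> E"
    using green_L_subset_D[of M] green_L_subset_D[of S] by (auto simp: E_def eq_L)
  moreover have "green_R T \<subseteq> E"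
    using green_R_subset_D[of M] green_R_subset_D[of S] by (auto simp: E_def eq_R)
  ultimately show ?thesis
    using green_D_least[of T E] assms by (auto simp: E_def)
qed

lemma eq_D_lift:
  assumes "(a, b) \<in> green_D S" and j: "j \<in> carrier M"
  shows "((j, a), (j, b)) \<in> green_D T"
proof -
  \<comment> \<open>\<open>E\<close> is the pullback of D of \<open>T\<close> along the map sending
    \<open>a\<close> to \<open>(j, a)\<close>. Fixing the first coordinate turns each L-step or
    R-step in \<open>S\<close> into one in \<open>T\<close>, because \<open>j\<close> is L-related
    and R-related to itself.\<close>
  define E where
    "E = {(a, b). a \<in> carrier S \<and> b \<in> carrier S \<and> ((j, a), (j, b)) \<in> green_D T}"
  note eqT = equiv_green_D[of T]
  have jj: "(j, j) \<in> green_L M"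
    using M.equiv_green_L j by (auto simp: equiv_def refl_on_def)
  have "equiv (carrier S) E"
  proof (rule equivI)
    show "E \<subseteq> carrier S \<times> carrier S"
      by (auto simp: E_def)
    show "refl_on (carrier S) E"
      using eqT j by (auto simp: E_def equiv_def refl_on_def)
    show "sym E"
      using eqT by (auto simp: E_def equiv_def sym_def)
    show "trans E"
      using eqT unfolding E_def equiv_def trans_def by blast
  qed
  moreover have "green_L S \<subseteq> E"
    using green_L_subset_D[of T] green_L_carrier[of S] jj by (auto simp: E_def eq_L)
  \<comment> \<open>The fact \<open>jj\<close> is about L; commutativity of \<open>M\<close> makes
    it available for R too.\<close>
  moreover have "green_R S \<subseteq> E"
    using green_R_subset_D[of T] green_R_carrier[of S] jj
    by (auto simp: E_def eq_R M.green_R_eq_L)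
  ultimately show ?thesis
    using green_D_least[of S E] assms by (auto simp: E_def)
qed

text \<open>For the converse the coordinates change one after the other, so that no chain of L-steps
  and R-steps in \<open>M\<close> has to be aligned with one in \<open>S\<close>. The change in
  \<open>M\<close> is a single L-step.\<close>

lemma eq_D: "((i, a), (j, b)) \<in> green_D T \<longleftrightarrow> (i, j) \<in> green_D M \<and> (a, b) \<in> green_D S"
proof
  assume *: "(i, j) \<in> green_D M \<and> (a, b) \<in> green_D S"
  then have ij: "(i, j) \<in> green_L M"
    by (simp add: M.green_D_eq_L)
  have "a \<in> carrier S"
    using * equiv_green_D[of S] by (auto simp: equiv_def)
  then have "(a, a) \<in> green_L S"
    using S.equiv_green_L by (auto simp: equiv_def refl_on_def)
  with ij have "((i, a), (j, a)) \<in> green_D T"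
    using eq_L green_L_subset_D by blast
  moreover have "((j, a), (j, b)) \<in> green_D T"
    using eq_D_lift * ij green_L_carrier by blast
  ultimately show "((i, a), (j, b)) \<in> green_D T"
    using equiv_green_D[of T] by (meson equivE transE)
qed (rule eq_D_project)

text \<open>The cases of H and J arise from the pre-orders by intersection and converse, both of
  which are compatible with the coordinatewise description.\<close>

lemma green_rel_iff:
  "((i, a), (j, b)) \<in> green_rel \<xi> T \<longleftrightarrow> (i, j) \<in> green_rel \<xi> M \<and> (a, b) \<in> green_rel \<xi> S"
  by (cases \<xi>)
    (auto simp: le_L le_R le_J eq_L eq_R eq_D green_le_H_def green_J_def green_H_def)

end

theorem theorem5p1:
  fixes M :: "('m, 'x) monoid_scheme" and S :: "('s, 'y) monoid_scheme"
    and q :: 'm and \<Phi> :: "'s \<Rightarrow> 's \<Rightarrow> nat" and \<xi> :: green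
    and i j :: 'm and a b :: 's
  assumes "monoid S" and "comm_monoid M" and "q \<in> carrier M"
    and "twisting S \<Phi>" and "tight S \<Phi>"
    and "i \<in> carrier M" and "j \<in> carrier M" and "a \<in> carrier S" and "b \<in> carrier S"
  shows "((i, a), (j, b)) \<in> green_rel \<xi> (twisted_product M q \<Phi> S) \<longleftrightarrow>
         (i, j) \<in> green_rel \<xi> M \<and> (a, b) \<in> green_rel \<xi> S"
proof -
  interpret tight_twisted_product M S q \<Phi>
    using assms by (simp add: tight_twisted_product_def tight_twisted_product_axioms_def)
  show ?thesis
    by (rule green_rel_iff)
qed

end
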